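(* For two short impartial games $G$ and $H$, the following are equivalent: (i) for all non-negative integers $n$, $g_G(n)=g_H(n)$; (ii) for all non-negative integers $m$, $s_G(m)=s_H(m)$; (iii) $G$ is strongly equal to $H$ modulo the nimbers.
   Context: All games are short impartial games under normal play (a player unable to move loses): a position is identified with its finite set of options, which are themselves short impartial games; there are no infinite plays. The empty game (no options) is denoted $0$. $G\equiv H$ means that $G$ and $H$ have the same option sets (are identical as games). $G+H$ is the disjunctive sum. A game is a $\mathcal P$-position if the previous player (the player not about to move) has a winning strategy, and an $\mathcal N$-position otherwise; this is its outcome. $G=0$ means that $G$ is a $\mathcal P$-position. The nimber $*n$ is the game with options $*k$, $0\le k<n$ ($*0\equiv 0$). The split sum $G\circ H$ is defined recursively by: $G\circ H\equiv 0$ if $G\equiv 0$; $G\circ H\equiv G$ if $H\equiv 0$; and otherwise $G\circ H\equiv\{G\circ h,\ g\circ H\}$, where $g$ ranges over the options of $G$ and $h$ over the options of $H$. $G$ and $H$ are strongly equal modulo a set $A$ of games if for all $X\in A$ and $Y\in A$, the outcomes of $(G+X)\circ Y$ and $(H+X)\circ Y$ are the same; "modulo the nimbers" means $A=\{*n : n\ge 0\}$. Extended Grundy function: for a game $G$ and a non-negative integer $n$, $g_G(n)$ is the non-negative integer (which exists and is unique) such that $(G+*g_G(n))\circ *n=0$. Extended split function: $s_G(n)$ is the non-negative integer, if it exists and is unique, such that $(G+*n)\circ *s_G(n)=0$; if such an integer does not exist or is not unique, $s_G(n)=\infty$. *)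

theory Defs
  imports "HOL-Library.FSet" "HOL-Library.Extended_Nat"
begin

text \<open>
  A position is its finite set of options, so HOL equality of games is identity
  (\<open>\<equiv>\<close> in the literature), not equality of outcomes or of Grundy values.
  There are no infinite plays because the datatype is well-founded.
\<close>

datatype game = Game (opts: "game fset")

definition zero_game :: game ("\<zero>")
  where "\<zero> = Game {||}"

lemma opts_zero_game [simp]: "opts \<zero> = {||}"
  by (simp add: zero_game_def)

lemma opts_eq_empty_iff [simp]: "opts G = {||} \<longleftrightarrow> G = \<zero>"
  by (cases G) (simp add: zero_game_def)

lemma size_opts [termination_simp]:
  assumes "G' |\<in>| opts G" shows "size G' < size G"
proof (cases G)
  case (Game A)
  have "size G' \<le> (\<Sum>x\<in>fset A. Suc (size x))"
    using assms Game by (intro order.trans[OF _ member_le_sum[of G']]) auto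
  then show ?thesis using Game by simp
qed


subsection \<open>Outcomes\<close>

text \<open>
  \<open>reached s G H\<close>: in some play from \<open>G\<close>, with the next player moving arbitrarily and the
  previous player answering each arrival at a position \<open>H'\<close> by moving to \<open>s H'\<close>, the
  position \<open>H\<close> occurs with the next player to move.
\<close>

inductive reached :: "(game \<Rightarrow> game) \<Rightarrow> game \<Rightarrow> game \<Rightarrow> bool" for s G where
  start: "reached s G G"
| reply: "reached s G H \<Longrightarrow> H' |\<in>| opts H \<Longrightarrow> reached s G (s H')"

text \<open>
  As plays are finite and a player unable to move loses, a strategy of the previous player wins
  iff it always supplies a legal answer.
\<close>

definition prev_winning_strategy :: "(game \<Rightarrow> game) \<Rightarrow> game \<Rightarrow> bool"
  where "prev_winning_strategy s G \<longleftrightarrow>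
    (\<forall>H H'. reached s G H \<longrightarrow> H' |\<in>| opts H \<longrightarrow> s H' |\<in>| opts H')"

definition P_position :: "game \<Rightarrow> bool"
  where "P_position G \<longleftrightarrow> (\<exists>s. prev_winning_strategy s G)"

datatype outcome = P_outcome | N_outcome

definition outcome :: "game \<Rightarrow> outcome"
  where "outcome G = (if P_position G then P_outcome else N_outcome)"

lemma reached_trans: "reached s H K \<Longrightarrow> reached s G H \<Longrightarrow> reached s G K"
  by (induction rule: reached.induct) (auto intro: reached.intros)

lemma P_position_reply:
  assumes "P_position G" "G' |\<in>| opts G"
  shows "\<exists>G''. G'' |\<in>| opts G' \<and> P_position G''"
proof -
  obtain s where s: "prev_winning_strategy s G"
    using assms by (auto simp: P_position_def)
  have "reached s G (s G')"
    using assms(2) by (auto intro: reached.intros)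
  then have "prev_winning_strategy s (s G')"
    using s by (auto simp: prev_winning_strategy_def intro: reached_trans)
  moreover have "s G' |\<in>| opts G'"
    using s assms(2) by (auto simp: prev_winning_strategy_def intro: reached.start)
  ultimately show ?thesis by (auto simp: P_position_def)
qed

lemma P_positionI:
  assumes "\<And>G'. G' |\<in>| opts G \<Longrightarrow> \<exists>G''. G'' |\<in>| opts G' \<and> P_position G''"
  shows "P_position G"
proof -
  define s where "s = (\<lambda>H'. SOME H''. H'' |\<in>| opts H' \<and> P_position H'')"
  have s: "s H' |\<in>| opts H' \<and> P_position (s H')"
    if "\<exists>H''. H'' |\<in>| opts H' \<and> P_position H''" for H'
    unfolding s_def using that by (rule someI_ex)
  have inv: "H' |\<in>| opts H \<Longrightarrow> \<exists>H''. H'' |\<in>| opts H' \<and> P_position H''"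
    if "reached s G H" for H H'
    using that
  proof (induction arbitrary: H')
    case start
    then show ?case by (rule assms)
  next
    case (reply H K)
    then show ?case using s P_position_reply by blast
  qed
  have "prev_winning_strategy s G"
    using inv s by (auto simp: prev_winning_strategy_def)
  then show ?thesis by (auto simp: P_position_def)
qed

lemma not_P_position_option:
  "P_position G \<Longrightarrow> G' |\<in>| opts G \<Longrightarrow> \<not> P_position G'"
proof (induction G arbitrary: G' rule: measure_induct_rule[of size])
  case (less G)
  show ?case
  proof
    assume P: "P_position G'"
    obtain G'' where G'': "G'' |\<in>| opts G'" "P_position G''"
      using P_position_reply[OF less.prems] by blast
    have "\<not> P_position G''"
      using less.IH[of G' G''] P G''(1) size_opts[OF less.prems(2)] by blast
    with G'' show False by simp
  qed
qed

lemma P_position_iff: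
  "P_position G \<longleftrightarrow> (\<forall>G'. G' |\<in>| opts G \<longrightarrow> \<not> P_position G')"
proof (induction G rule: measure_induct_rule[of size])
  case (less G)
  show ?case
  proof
    assume "\<forall>G'. G' |\<in>| opts G \<longrightarrow> \<not> P_position G'"
    then show "P_position G"
      using less.IH size_opts by (intro P_positionI) blast
  qed (use not_P_position_option in blast)
qed


subsection \<open>Sums and nimbers\<close>

function game_sum :: "game \<Rightarrow> game \<Rightarrow> game" (infixl "\<oplus>" 65) where
  "G \<oplus> H = Game ((\<lambda>G'. G' \<oplus> H) |`| opts G |\<union>| (\<lambda>H'. G \<oplus> H') |`| opts H)"
  by pat_completeness auto
termination
  by (relation "measure (\<lambda>(G, H). size G + size H)") (auto simp: size_opts)

function split_sum :: "game \<Rightarrow> game \<Rightarrow> game" (infixl "\<odot>" 70) where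
  "G \<odot> H =
    (if G = \<zero> then \<zero>
     else if H = \<zero> then G
     else Game ((\<lambda>H'. G \<odot> H') |`| opts H |\<union>| (\<lambda>G'. G' \<odot> H) |`| opts G))"
  by pat_completeness auto
termination
  by (relation "measure (\<lambda>(G, H). size G + size H)") (auto simp: size_opts)

declare game_sum.simps [simp del] split_sum.simps [simp del]

function nimber :: "nat \<Rightarrow> game" where
  "nimber n = Game (nimber |`| fset_of_list [0..<n])"
  by pat_completeness auto
termination
  by (relation "measure id") (auto simp: fset_of_list_elem)

declare nimber.simps [simp del]

lemma opts_nimber: "G |\<in>| opts (nimber n) \<longleftrightarrow> (\<exists>k<n. G = nimber k)"
  by (subst nimber.simps) (auto simp: fset_of_list_elem)

lemma fset_opts_nimber: "fset (opts (nimber n)) = nimber ` {..<n}"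
  by (auto simp: opts_nimber)

lemma nimber_0 [simp]: "nimber 0 = \<zero>"
  by (subst nimber.simps) (simp add: zero_game_def)


subsection \<open>Strong equality and the extended functions\<close>

definition strongly_equal_modulo :: "game set \<Rightarrow> game \<Rightarrow> game \<Rightarrow> bool"
  where "strongly_equal_modulo A G H \<longleftrightarrow>
    (\<forall>X\<in>A. \<forall>Y\<in>A. outcome ((G \<oplus> X) \<odot> Y) = outcome ((H \<oplus> X) \<odot> Y))"

definition ext_grundy :: "game \<Rightarrow> nat \<Rightarrow> nat"
  where "ext_grundy G n = (THE m. P_position ((G \<oplus> nimber m) \<odot> nimber n))"

text \<open>The value \<open>m\<close> in the definition of the extended Grundy function exists and is unique.\<close>

lemma opts_game_sum: "K |\<in>| opts (G \<oplus> H) \<longleftrightarrow>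
    (\<exists>G'. G' |\<in>| opts G \<and> K = G' \<oplus> H) \<or> (\<exists>H'. H' |\<in>| opts H \<and> K = G \<oplus> H')"
  by (subst game_sum.simps) auto

lemma zero_split_sum [simp]: "\<zero> \<odot> H = \<zero>"
  by (subst split_sum.simps) simp

lemma split_sum_zero [simp]: "G \<odot> \<zero> = G"
  by (subst split_sum.simps) simp

lemma nimber_eq_zero_iff [simp]: "nimber n = \<zero> \<longleftrightarrow> n = 0"
  using opts_nimber[of \<zero> n] by (cases "n = 0") force+

lemma opts_split_sum_nimber:
  assumes "G \<noteq> \<zero>"
  shows "K |\<in>| opts (G \<odot> nimber n) \<longleftrightarrow>
    (\<exists>k<n. K = G \<odot> nimber k) \<or> (\<exists>G'. G' |\<in>| opts G \<and> K = G' \<odot> nimber n)"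
proof (cases "n = 0")
  case False
  then show ?thesis
    using assms by (subst split_sum.simps) (auto simp: fset_opts_nimber)
qed simp

lemma P_position_zero [simp]: "P_position \<zero>"
  by (subst P_position_iff) simp

lemma ext_grundy_unique:
  assumes "P_position ((G \<oplus> nimber a) \<odot> nimber n)" "P_position ((G \<oplus> nimber b) \<odot> nimber n)"
  shows "a = b"
proof -
  have False
    if P: "P_position ((G \<oplus> nimber a) \<odot> nimber n)" "P_position ((G \<oplus> nimber b) \<odot> nimber n)"
      and "a < b" for a b
  proof -
    have 1: "G \<oplus> nimber a |\<in>| opts (G \<oplus> nimber b)"
      using \<open>a < b\<close> by (auto simp: opts_game_sum opts_nimber)
    then have "G \<oplus> nimber b \<noteq> \<zero>" by auto
    then have "(G \<oplus> nimber a) \<odot> nimber n |\<in>| opts ((G \<oplus> nimber b) \<odot> nimber n)"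
      using 1 by (auto simp: opts_split_sum_nimber)
    then show False using P not_P_position_option by blast
  qed
  then show ?thesis using assms by (metis linorder_neqE_nat)
qed

lemma ext_grundy_exists: "\<exists>m. P_position ((G \<oplus> nimber m) \<odot> nimber n)"
proof (rule ccontr)
  assume no: "\<nexists>m. P_position ((G \<oplus> nimber m) \<odot> nimber n)"
  define I where "I = {G} \<times> {..<n} \<union> fset (opts G) \<times> {n}"
  have "\<exists>p\<in>I. P_position ((fst p \<oplus> nimber m) \<odot> nimber (snd p))" for m
  proof -
    have nz: "G \<oplus> nimber m \<noteq> \<zero>" using no by (metis P_position_zero zero_split_sum)
    obtain K where K: "K |\<in>| opts ((G \<oplus> nimber m) \<odot> nimber n)" "P_position K"
      using no P_position_iff by blast
    then consider k where "k < n" "K = (G \<oplus> nimber m) \<odot> nimber k"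
      | G' where "G' |\<in>| opts (G \<oplus> nimber m)" "K = G' \<odot> nimber n"
      using nz by (auto simp: opts_split_sum_nimber)
    then show ?thesis
    proof cases
      case 1
      then show ?thesis using K by (intro bexI[of _ "(G, k)"]) (auto simp: I_def)
    next
      case 2
      then obtain G0 where "G0 |\<in>| opts G" "G' = G0 \<oplus> nimber m"
        using K no by (auto simp: opts_game_sum opts_nimber)
      then show ?thesis using K 2 by (intro bexI[of _ "(G0, n)"]) (auto simp: I_def)
    qed
  qed
  then obtain f where f: "\<And>m. f m \<in> I"
    "\<And>m. P_position ((fst (f m) \<oplus> nimber m) \<odot> nimber (snd (f m)))"
    by metis
  have "inj f" by (rule injI) (metis f(2) ext_grundy_unique)
  moreover have "finite (range f)"
  proof (rule finite_subset)
    show "range f \<subseteq> I" using f(1) by blast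
    show "finite I" by (simp add: I_def)
  qed
  ultimately show False using finite_imageD infinite_UNIV_nat by blast
qed

lemma P_position_ext_grundy: "P_position ((G \<oplus> nimber (ext_grundy G n)) \<odot> nimber n)"
  unfolding ext_grundy_def using ext_grundy_exists ext_grundy_unique by (metis (lifting) theI)

definition ext_split :: "game \<Rightarrow> nat \<Rightarrow> enat"
  where "ext_split G n =
    (if \<exists>!k. P_position ((G \<oplus> nimber n) \<odot> nimber k)
     then enat (THE k. P_position ((G \<oplus> nimber n) \<odot> nimber k))
     else \<infinity>)"

end

theory Submission
  imports Defs
begin

text \<open>
  The three conditions describe one relation between numbers: \<open>m\<close> and \<open>n\<close> are related if
  \<open>(G \<oplus> nimber m) \<odot> nimber n\<close> is a previous-player win.  For each \<open>n\<close> there is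
  exactly one such \<open>m\<close>, so the relation is the (transposed) graph of the extended Grundy function,
  and equality of the Grundy functions is equality of the relations, which is strong equality
  modulo the nimbers.

  The extended split function reads the same relation in the other direction.  It is computed from
  the relation, so equal relations give equal split functions.  Conversely, if \<open>G\<close> is not the empty
  game then neither is \<open>G \<oplus> nimber m\<close>, and a smaller nimber on the right of \<open>\<odot>\<close> can be reached by a
  move; so the Grundy function is injective and the finite values of the split function form its
  partial inverse.  For the empty game every \<open>n\<close> is related to \<open>0\<close>, and the split function is
  \<open>\<infinity>\<close> everywhere.  This constant function is not the split function of any other game, because a
  nonempty game takes the finite value \<open>n\<close> at its Grundy value for \<open>n\<close>.  So the split
  function determines the relation in all cases.
\<close>

lemma P_position_iff_ext_grundy:
  "P_position ((G \<oplus> nimber m) \<odot> nimber n) \<longleftrightarrow> ext_grundy G n = m"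
  using P_position_ext_grundy ext_grundy_unique by blast

lemma game_sum_eq_zero_iff: "G \<oplus> H = \<zero> \<longleftrightarrow> G = \<zero> \<and> H = \<zero>"
  unfolding opts_eq_empty_iff[symmetric] by (subst game_sum.simps) auto

lemma outcome_eq_iff: "outcome G = outcome H \<longleftrightarrow> (P_position G \<longleftrightarrow> P_position H)"
  by (simp add: outcome_def)

lemma strongly_equal_modulo_nimbers_iff:
  "strongly_equal_modulo (range nimber) G H \<longleftrightarrow> (\<forall>n. ext_grundy G n = ext_grundy H n)"
  by (auto simp: strongly_equal_modulo_def outcome_eq_iff P_position_iff_ext_grundy)

text \<open>
  Lowering the right component is a legal move in the split sum only while the left component is
  nonempty, which is why the empty game is excluded.
\<close>

lemma split_sum_nimber_P_position_unique:
  assumes "K \<noteq> \<zero>" "P_position (K \<odot> nimber a)" "P_position (K \<odot> nimber b)"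
  shows "a = b"
proof -
  have "\<not> P_position (K \<odot> nimber i)" if "i < j" "P_position (K \<odot> nimber j)" for i j
  proof (rule not_P_position_option[OF that(2)])
    show "K \<odot> nimber i |\<in>| opts (K \<odot> nimber j)"
      using assms(1) that(1) by (auto simp: opts_split_sum_nimber)
  qed
  with assms(2,3) show ?thesis by (metis linorder_neqE_nat)
qed

lemma inj_ext_grundy:
  assumes "G \<noteq> \<zero>" shows "inj (ext_grundy G)"
proof (rule injI)
  fix a b assume "ext_grundy G a = ext_grundy G b"
  then have "P_position ((G \<oplus> nimber (ext_grundy G a)) \<odot> nimber b)"
    by (simp add: P_position_iff_ext_grundy)
  with P_position_ext_grundy[of G a] show "a = b"
    using assms by (intro split_sum_nimber_P_position_unique) (auto simp: game_sum_eq_zero_iff)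
qed

lemma ext_grundy_zero: "ext_grundy \<zero> n = 0"
proof -
  have "\<zero> \<oplus> \<zero> = \<zero>" by (simp add: game_sum_eq_zero_iff)
  then show ?thesis using P_position_iff_ext_grundy[of \<zero> 0 n] by simp
qed

text \<open>
  For a nonempty game uniqueness of \<open>n\<close> comes for free from injectivity of the Grundy function; for
  the empty game all \<open>n\<close> have Grundy value \<open>0\<close>, so uniqueness fails and no finite value occurs.
\<close>

lemma ext_split_eq_enat_iff:
  "ext_split G m = enat n \<longleftrightarrow> G \<noteq> \<zero> \<and> ext_grundy G n = m"
proof (cases "G = \<zero>")
  case True
  then have "\<not> (\<exists>!k. ext_grundy G k = m)"
    by (metis ext_grundy_zero n_not_Suc_n)
  with True show ?thesis
    by (simp add: ext_split_def P_position_iff_ext_grundy)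
next
  case False
  then have uniq: "a = b" if "ext_grundy G a = m" "ext_grundy G b = m" for a b
    using that inj_ext_grundy by (metis injD)
  show ?thesis
  proof (cases "\<exists>k. ext_grundy G k = m")
    case True
    then obtain k where k: "ext_grundy G k = m" by blast
    with uniq have "(THE k. ext_grundy G k = m) = k" by blast
    with k uniq False show ?thesis
      by (auto simp: ext_split_def P_position_iff_ext_grundy)
  qed (auto simp: ext_split_def P_position_iff_ext_grundy)
qed

lemma ext_split_eq_iff_ext_grundy_eq:
  "(\<forall>m. ext_split G m = ext_split H m) \<longleftrightarrow> (\<forall>n. ext_grundy G n = ext_grundy H n)"
proof
  assume "\<forall>m. ext_split G m = ext_split H m"
  then have graph: "G \<noteq> \<zero> \<and> ext_grundy G n = m \<longleftrightarrow> H \<noteq> \<zero> \<and> ext_grundy H n = m" for m n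
    by (metis ext_split_eq_enat_iff)
  show "\<forall>n. ext_grundy G n = ext_grundy H n"
  proof (cases "G = \<zero>")
    case True
    with graph have "H = \<zero>" by blast
    with True show ?thesis by simp
  next
    case False
    with graph show ?thesis by metis
  qed
qed (simp add: ext_split_def P_position_iff_ext_grundy)

theorem theorem8:
  fixes G H :: game
  shows "((\<forall>n. ext_grundy G n = ext_grundy H n) \<longleftrightarrow> (\<forall>m. ext_split G m = ext_split H m))
    \<and> ((\<forall>m. ext_split G m = ext_split H m) \<longleftrightarrow> strongly_equal_modulo (range nimber) G H)"
  unfolding ext_split_eq_iff_ext_grundy_eq strongly_equal_modulo_nimbers_iff by simp

end
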